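(* Let $G$ be a finite undirected graph (multiple edges and loops allowed) and $v\in V(G)$. Then: (1) each ideal $I$ of $\mathrm{Tisg}(G,v)$ has a basis; (2) that basis is unique up to isomorphism; (3) each generating set of graphs for an ideal $I$ of $\mathrm{Tisg}(G,v)$ contains a basis; (4) the union of ideals $I,J$ of $\mathrm{Tisg}(G,v)$ has a generating set of graphs which is the union of the bases of $I$ and $J$; (5) given any ideals $I,K$ of $\mathrm{Tisg}(G,v)$ with $I\subseteq K$, the elements of the basis for $I$ are connected induced subgraphs of the elements of the basis for $K$ and contain $v$.
   Context: Graphs are finite and undirected and may have multiple edges and loops. For $X\subseteq V(G)$, $G[X]$ is the subgraph of $G$ induced by $X$. A $v$-rooted tree induced subgraph of $G$ is a subgraph $H=G[V(T)]$ for some tree $T$ in $G$ rooted at $v$ (equivalently, a connected induced subgraph containing $v$). $\mathrm{Tisg}(G,v)$ is the set of all graph isomorphisms $\varphi:H\to J$ (bijections on vertices and on edges preserving incidence) with $H,J$ $v$-rooted tree induced subgraphs of $G$ and $\varphi(v)=v$. For $\varphi,\psi\in\mathrm{Tisg}(G,v)$, let $C_{\psi\circ\varphi}$ be the subgraph of $G$ induced by the set of all vertices $u$ for which there is a path from $v$ to $u$ contained in both $\mathrm{Im}(\varphi)$ and $\mathrm{Dom}(\psi)$; the product $\psi\circ\varphi:\varphi^{-1}(C_{\psi\circ\varphi})\to\psi(C_{\psi\circ\varphi})$ is the restriction of "apply $\varphi$, then $\psi$" to $\varphi^{-1}(C_{\psi\circ\varphi})$. An ideal of a semigroup $S$ is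 a subset $I\subseteq S$ with $SI\subseteq I$ and $IS\subseteq I$. A generating set of graphs for an ideal $I$ of $\mathrm{Tisg}(G,v)$ is a collection $\mathcal B$ of connected induced subgraphs of $G$ containing $v$ such that for every $a\in I$ the domain of $a$ is isomorphic to a connected induced subgraph of some $B\in\mathcal B$ containing $v$, and for each $B\in\mathcal B$ there is $a\in I$ whose domain is isomorphic to $B$. A basis of $I$ is a generating set of graphs for $I$ that is minimal (with respect to inclusion).
   Formalization: "Isomorphic" (in generating set, basis and uniqueness) is read as isomorphism fixing v, since with isomorphisms that may move v uniqueness (2) fails; in (5) "the basis" is taken up to such isomorphism, or literally for a suitable basis of I. *)

theory Defs
  imports Main "HOL-Library.FuncSet"
begin

text \<open>
  Undirected graphs with multiple edges and loops. The end points of an edge form a set with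
  one element (a loop) or two elements.
\<close>

record ('v, 'e) mgraph =
  verts :: "'v set"
  edges :: "'e set"
  ends :: "'e \<Rightarrow> 'v set"

definition multigraph :: "('v, 'e) mgraph \<Rightarrow> bool" where
  "multigraph G \<longleftrightarrow> (\<forall>e\<in>edges G. ends G e \<subseteq> verts G \<and> card (ends G e) \<in> {1, 2})"

definition finite_multigraph :: "('v, 'e) mgraph \<Rightarrow> bool" where
  "finite_multigraph G \<longleftrightarrow> multigraph G \<and> finite (verts G) \<and> finite (edges G)"

text \<open>
  Subgraphs carry the whole end point function of the ambient graph, so that two
  subgraphs are equal as records iff they have the same vertices and the same edges.
\<close>

definition subgraph :: "('v, 'e) mgraph \<Rightarrow> ('v, 'e) mgraph \<Rightarrow> bool" where
  "subgraph H G \<longleftrightarrow> multigraph H \<and> verts H \<subseteq> verts G \<and> edges H \<subseteq> edges G \<and> ends H = ends G"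

definition induce :: "('v, 'e) mgraph \<Rightarrow> 'v set \<Rightarrow> ('v, 'e) mgraph" where
  "induce G X = \<lparr>verts = X, edges = {e \<in> edges G. ends G e \<subseteq> X}, ends = ends G\<rparr>"

text \<open>
  A walk \<open>u, e\<^sub>1, x\<^sub>1, \<dots>, e\<^sub>n, x\<^sub>n = w\<close> is represented by its start \<open>u\<close> and
  the list \<open>[(e\<^sub>1, x\<^sub>1), \<dots>, (e\<^sub>n, x\<^sub>n)]\<close>.
\<close>

fun walk :: "('v, 'e) mgraph \<Rightarrow> 'v \<Rightarrow> ('e \<times> 'v) list \<Rightarrow> 'v \<Rightarrow> bool" where
  "walk H u [] w \<longleftrightarrow> u \<in> verts H \<and> u = w"
| "walk H u ((e, x) # p) w \<longleftrightarrow>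
     u \<in> verts H \<and> e \<in> edges H \<and> ends H e = {u, x} \<and> walk H x p w"

definition path :: "('v, 'e) mgraph \<Rightarrow> 'v \<Rightarrow> ('e \<times> 'v) list \<Rightarrow> 'v \<Rightarrow> bool" where
  "path H u p w \<longleftrightarrow> walk H u p w \<and> distinct (u # map snd p)"

definition connected_graph :: "('v, 'e) mgraph \<Rightarrow> bool" where
  "connected_graph H \<longleftrightarrow> verts H \<noteq> {} \<and> (\<forall>u\<in>verts H. \<forall>w\<in>verts H. \<exists>p. path H u p w)"

text \<open>
  A loop is a cycle of length 1 and two parallel edges form a cycle of length 2; requiring
  distinct edges excludes going back and forth along a single edge.
\<close>

definition cycle :: "('v, 'e) mgraph \<Rightarrow> 'v \<Rightarrow> ('e \<times> 'v) list \<Rightarrow> bool" where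
  "cycle H u p \<longleftrightarrow> p \<noteq> [] \<and> walk H u p u \<and> distinct (map fst p) \<and> distinct (map snd p)"

definition tree :: "('v, 'e) mgraph \<Rightarrow> bool" where
  "tree T \<longleftrightarrow> connected_graph T \<and> (\<nexists>u p. cycle T u p)"

definition rooted_tree_induced_subgraphs ::
    "('v, 'e) mgraph \<Rightarrow> 'v \<Rightarrow> ('v, 'e) mgraph set" where
  "rooted_tree_induced_subgraphs G v =
     {induce G (verts T) | T. subgraph T G \<and> tree T \<and> v \<in> verts T}"

definition connected_induced_subgraphs ::
    "('v, 'e) mgraph \<Rightarrow> 'v \<Rightarrow> ('v, 'e) mgraph set" where
  "connected_induced_subgraphs G v =
     {induce G X | X. X \<subseteq> verts G \<and> v \<in> X \<and> connected_graph (induce G X)}"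

definition graph_iso ::
    "('v, 'e) mgraph \<Rightarrow> ('v, 'e) mgraph \<Rightarrow> ('v \<Rightarrow> 'v) \<Rightarrow> ('e \<Rightarrow> 'e) \<Rightarrow> bool" where
  "graph_iso H J f g \<longleftrightarrow>
     bij_betw f (verts H) (verts J) \<and> bij_betw g (edges H) (edges J) \<and>
     (\<forall>x\<in>verts H. \<forall>e\<in>edges H. x \<in> ends H e \<longleftrightarrow> f x \<in> ends J (g e))"

text \<open>
  All graphs compared below contain the root \<open>v\<close>, and \<open>isomorphic\<close> is understood for rooted
  graphs, i.e. the isomorphism fixes \<open>v\<close>, as do the elements of \<open>Tisg\<close>. If isomorphisms could
  move \<open>v\<close>, bases would not be unique up to isomorphism.
\<close>

definition isomorphic :: "'v \<Rightarrow> ('v, 'e) mgraph \<Rightarrow> ('v, 'e) mgraph \<Rightarrow> bool" where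
  "isomorphic v H J \<longleftrightarrow> (\<exists>f g. graph_iso H J f g \<and> f v = v)"

text \<open>
  An isomorphism together with its domain and image. The two maps are required to be
  \<open>extensional\<close>, so that equality of records is equality of isomorphisms.
\<close>

record ('v, 'e) piso =
  Dom :: "('v, 'e) mgraph"
  Im :: "('v, 'e) mgraph"
  vmap :: "'v \<Rightarrow> 'v"
  emap :: "'e \<Rightarrow> 'e"

definition Tisg :: "('v, 'e) mgraph \<Rightarrow> 'v \<Rightarrow> ('v, 'e) piso set" where
  "Tisg G v = {\<phi>.
     Dom \<phi> \<in> rooted_tree_induced_subgraphs G v \<and>
     Im \<phi> \<in> rooted_tree_induced_subgraphs G v \<and>
     graph_iso (Dom \<phi>) (Im \<phi>) (vmap \<phi>) (emap \<phi>) \<and>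
     vmap \<phi> \<in> extensional (verts (Dom \<phi>)) \<and>
     emap \<phi> \<in> extensional (edges (Dom \<phi>)) \<and>
     vmap \<phi> v = v}"

definition core :: "('v, 'e) mgraph \<Rightarrow> 'v \<Rightarrow> ('v, 'e) piso \<Rightarrow> ('v, 'e) piso \<Rightarrow> ('v, 'e) mgraph"
  where
  "core G v \<psi> \<phi> = induce G {u. \<exists>p. path (Im \<phi>) v p u \<and> path (Dom \<psi>) v p u}"

definition image_graph :: "('v, 'e) piso \<Rightarrow> ('v, 'e) mgraph \<Rightarrow> ('v, 'e) mgraph" where
  "image_graph \<psi> C =
     \<lparr>verts = vmap \<psi> ` verts C, edges = emap \<psi> ` edges C, ends = ends (Im \<psi>)\<rparr>"

definition preimage_graph :: "('v, 'e) piso \<Rightarrow> ('v, 'e) mgraph \<Rightarrow> ('v, 'e) mgraph" where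
  "preimage_graph \<phi> C =
     \<lparr>verts = {x \<in> verts (Dom \<phi>). vmap \<phi> x \<in> verts C},
      edges = {e \<in> edges (Dom \<phi>). emap \<phi> e \<in> edges C},
      ends = ends (Dom \<phi>)\<rparr>"

text \<open>As in \<open>\<psi> \<circ> \<phi>\<close>, the argument \<open>\<phi>\<close> is applied first.\<close>

definition tisg_mult ::
    "('v, 'e) mgraph \<Rightarrow> 'v \<Rightarrow> ('v, 'e) piso \<Rightarrow> ('v, 'e) piso \<Rightarrow> ('v, 'e) piso" where
  "tisg_mult G v \<psi> \<phi> =
     (let C = core G v \<psi> \<phi>; P = preimage_graph \<phi> C in
      \<lparr>Dom = P, Im = image_graph \<psi> C,
       vmap = restrict (vmap \<psi> \<circ> vmap \<phi>) (verts P),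
       emap = restrict (emap \<psi> \<circ> emap \<phi>) (edges P)\<rparr>)"

definition semigroup_ideal :: "'a set \<Rightarrow> ('a \<Rightarrow> 'a \<Rightarrow> 'a) \<Rightarrow> 'a set \<Rightarrow> bool" where
  "semigroup_ideal S f I \<longleftrightarrow> I \<subseteq> S \<and> (\<forall>s\<in>S. \<forall>a\<in>I. f s a \<in> I \<and> f a s \<in> I)"

abbreviation tisg_ideal :: "('v, 'e) mgraph \<Rightarrow> 'v \<Rightarrow> ('v, 'e) piso set \<Rightarrow> bool" where
  "tisg_ideal G v \<equiv> semigroup_ideal (Tisg G v) (tisg_mult G v)"

definition generating_set ::
    "('v, 'e) mgraph \<Rightarrow> 'v \<Rightarrow> ('v, 'e) piso set \<Rightarrow> ('v, 'e) mgraph set \<Rightarrow> bool" where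
  "generating_set G v I \<B> \<longleftrightarrow>
     \<B> \<subseteq> connected_induced_subgraphs G v \<and>
     (\<forall>a\<in>I. \<exists>B\<in>\<B>. \<exists>H\<in>connected_induced_subgraphs B v. isomorphic v (Dom a) H) \<and>
     (\<forall>B\<in>\<B>. \<exists>a\<in>I. isomorphic v (Dom a) B)"

definition basis ::
    "('v, 'e) mgraph \<Rightarrow> 'v \<Rightarrow> ('v, 'e) piso set \<Rightarrow> ('v, 'e) mgraph set \<Rightarrow> bool" where
  "basis G v I \<B> \<longleftrightarrow> generating_set G v I \<B> \<and> (\<forall>\<A>. \<A> \<subset> \<B> \<longrightarrow> \<not> generating_set G v I \<A>)"

end

theory Submission
  imports Defs
begin

text \<open>
  Rooted embeddability \<open>H \<preceq> K\<close> (\<open>H\<close> is isomorphic to a connected induced subgraph of \<open>K\<close>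
  containing \<open>v\<close>) is a preorder on the finitely many connected induced subgraphs of \<open>G\<close>
  containing \<open>v\<close>, and, comparing numbers of vertices, \<open>H \<preceq> K \<preceq> H\<close> forces \<open>H \<cong> K\<close>.
  A minimal generating set is an antichain for \<open>\<preceq>\<close>, and any two generating sets of the same
  ideal dominate each other, so two bases are matched up to isomorphism. Existence of bases
  inside generating sets is finiteness; all domains of elements of \<open>I\<close> generate \<open>I\<close>.
\<close>

section \<open>Induced subgraphs and transport of walks\<close>

lemma multigraph_induce: "multigraph G \<Longrightarrow> multigraph (induce G X)"
  by (auto simp: multigraph_def induce_def)

lemma induce_induce: "X \<subseteq> Y \<Longrightarrow> induce (induce G Y) X = induce G X"
  by (auto simp: induce_def)

lemma walk_in_verts: "walk H u p w \<Longrightarrow> u \<in> verts H \<and> set (map snd p) \<subseteq> verts H"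
  by (induction H u p w rule: walk.induct) auto

lemma walk_map:
  assumes "\<And>x. x \<in> verts H \<Longrightarrow> f x \<in> verts J" "\<And>e. e \<in> edges H \<Longrightarrow> g e \<in> edges J"
    and "\<And>e. e \<in> edges H \<Longrightarrow> ends J (g e) = f ` ends H e"
  shows "walk H u p w \<Longrightarrow> walk J (f u) (map (map_prod g f) p) (f w)"
  by (induction p arbitrary: u) (use assms in auto)

text \<open>Paths are carried over by \<open>f\<close> and \<open>g\<close>: injectivity of
  \<open>f\<close> keeps their vertices distinct, surjectivity reaches every vertex of
  \<open>J\<close>. Since \<open>g\<close> is only asked to send edges to edges, this covers
  isomorphisms as well as passing from a tree to the induced subgraph on its vertices.\<close>

lemma connected_graph_image:
  assumes "connected_graph H" and "bij_betw f (verts H) (verts J)"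
    and "\<And>e. e \<in> edges H \<Longrightarrow> g e \<in> edges J"
    and "\<And>e. e \<in> edges H \<Longrightarrow> ends J (g e) = f ` ends H e"
  shows "connected_graph J"
  unfolding connected_graph_def
proof (intro conjI ballI)
  show "verts J \<noteq> {}"
    using assms(1,2) by (auto simp: connected_graph_def bij_betw_def)
  fix u w assume "u \<in> verts J" "w \<in> verts J"
  then obtain u' w' where u': "u' \<in> verts H" "u = f u'" and w': "w' \<in> verts H" "w = f w'"
    using assms(2) unfolding bij_betw_def by blast
  obtain p where p: "walk H u' p w'" "distinct (u' # map snd p)"
    using assms(1) u'(1) w'(1) unfolding connected_graph_def path_def by blast
  have "walk J u (map (map_prod g f) p) w"
    using walk_map[of H f J g, OF _ assms(3,4) p(1)] bij_betwE[OF assms(2)] u' w' by simp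
  moreover have "inj_on f (set (u' # map snd p))"
    using walk_in_verts[OF p(1)] bij_betw_imp_inj_on[OF assms(2)] inj_on_subset
    by (metis insert_subset list.simps(15))
  then have "distinct (map f (u' # map snd p))"
    using p(2) by (simp only: distinct_map)
  then have "distinct (u # map snd (map (map_prod g f) p))"
    by (simp add: u'(2) comp_def)
  ultimately show "\<exists>p. path J u p w"
    unfolding path_def by blast
qed

text \<open>Incidence in \<open>graph_iso\<close> is tested on vertices of \<open>H\<close> alone.
  Equality of end point sets follows because the ends of an edge are vertices and \<open>f\<close>
  is onto \<open>verts J\<close>.\<close>

lemma graph_iso_ends:
  assumes "multigraph H" "multigraph J" "graph_iso H J f g" "e \<in> edges H"
  shows "ends J (g e) = f ` ends H e"
proof -
  have "g e \<in> edges J" "f ` verts H = verts J"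
    using assms(3,4) by (auto simp: graph_iso_def bij_betw_def)
  then have "ends H e \<subseteq> verts H" "ends J (g e) \<subseteq> f ` verts H"
    using assms by (auto simp: multigraph_def)
  then show ?thesis
    using assms(3,4) unfolding graph_iso_def by blast
qed

section \<open>Rooted isomorphism as an equivalence\<close>

lemma isomorphic_refl: "isomorphic v H H"
  unfolding isomorphic_def graph_iso_def by (rule exI[of _ id], rule exI[of _ id]) auto

lemma isomorphic_sym:
  assumes "isomorphic v H J" "v \<in> verts H" shows "isomorphic v J H"
proof -
  obtain f g where f: "bij_betw f (verts H) (verts J)" and g: "bij_betw g (edges H) (edges J)"
    and E: "\<forall>x\<in>verts H. \<forall>e\<in>edges H. x \<in> ends H e \<longleftrightarrow> f x \<in> ends J (g e)" and v: "f v = v"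
    using assms(1) by (auto simp: isomorphic_def graph_iso_def)
  let ?f = "inv_into (verts H) f" and ?g = "inv_into (edges H) g"
  have "x \<in> ends J e \<longleftrightarrow> ?f x \<in> ends H (?g e)" if "x \<in> verts J" "e \<in> edges J" for x e
    using that E bij_betwE[OF bij_betw_inv_into[OF f]] bij_betwE[OF bij_betw_inv_into[OF g]]
    by (simp add: bij_betw_inv_into_right[OF f] bij_betw_inv_into_right[OF g])
  then have "graph_iso J H ?f ?g"
    using f g by (auto simp: graph_iso_def bij_betw_inv_into)
  \<comment> \<open>The inverse is taken on \<open>verts H\<close>, so fixing the root relies on
    \<open>v \<in> verts H\<close>.\<close>
  moreover have "?f v = v"
    using bij_betw_inv_into_left[OF f assms(2)] v by simp
  ultimately show ?thesis
    by (auto simp: isomorphic_def)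
qed

lemma isomorphic_trans:
  assumes "isomorphic v H J" "isomorphic v J K" shows "isomorphic v H K"
proof -
  obtain f g where 1: "graph_iso H J f g" "f v = v"
    using assms(1) by (auto simp: isomorphic_def)
  obtain f' g' where 2: "graph_iso J K f' g'" "f' v = v"
    using assms(2) by (auto simp: isomorphic_def)
  have "graph_iso H K (f' \<circ> f) (g' \<circ> g)"
    using 1(1) 2(1) unfolding graph_iso_def
    by (auto intro: bij_betw_trans simp: bij_betwE)
  then show ?thesis
    using 1(2) 2(2) by (auto simp: isomorphic_def)
qed

section \<open>Connected induced subgraphs containing the root\<close>

lemma connected_induced_subgraphsD:
  assumes "H \<in> connected_induced_subgraphs G v"
  shows "verts H \<subseteq> verts G" "v \<in> verts H" "connected_graph H" "H = induce G (verts H)"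
  using assms by (auto simp: connected_induced_subgraphs_def induce_def)

text \<open>Makes rooted embeddability reflexive on these graphs and turns any isomorphism onto
  \<open>H\<close> into a rooted embedding.\<close>

lemma connected_induced_subgraphs_self:
  assumes "H \<in> connected_induced_subgraphs G v"
  shows "H \<in> connected_induced_subgraphs H v"
proof -
  have "induce H (verts H) = H"
    by (metis connected_induced_subgraphsD(4)[OF assms] induce_induce subset_refl)
  then show ?thesis
    using connected_induced_subgraphsD(2,3)[OF assms] unfolding connected_induced_subgraphs_def
    by (intro CollectI exI[of _ "verts H"]) simp
qed

lemma connected_induced_subgraphs_trans:
  assumes "H \<in> connected_induced_subgraphs K v" "K \<in> connected_induced_subgraphs G v"
  shows "H \<in> connected_induced_subgraphs G v"
proof -
  note H = connected_induced_subgraphsD[OF assms(1)]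
  note K = connected_induced_subgraphsD[OF assms(2)]
  have "induce K (verts H) = induce G (verts H)"
    by (subst K(4)) (rule induce_induce[OF H(1)])
  then have "induce G (verts H) = H"
    using H(4) by metis
  then show ?thesis
    using H(1-3) K(1) unfolding connected_induced_subgraphs_def
    by (intro CollectI exI[of _ "verts H"]) auto
qed

lemma multigraph_connected_induced_subgraph:
  "multigraph G \<Longrightarrow> H \<in> connected_induced_subgraphs G v \<Longrightarrow> multigraph H"
  by (auto simp: connected_induced_subgraphs_def multigraph_induce)

lemma finite_connected_induced_subgraphs:
  "finite (verts G) \<Longrightarrow> finite (connected_induced_subgraphs G v)"
  by (rule finite_subset[of _ "induce G ` Pow (verts G)"])
    (auto simp: connected_induced_subgraphs_def)

lemma isomorphic_connected_induced_subgraph: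
  assumes "multigraph K" "multigraph L" "isomorphic v K L"
    and "H \<in> connected_induced_subgraphs K v"
  shows "\<exists>J\<in>connected_induced_subgraphs L v. isomorphic v H J"
proof -
  obtain f g where iso: "graph_iso K L f g" and v: "f v = v"
    using assms(3) by (auto simp: isomorphic_def)
  note H = connected_induced_subgraphsD[OF assms(4)]
  have f: "bij_betw f (verts K) (verts L)" and g: "bij_betw g (edges K) (edges L)"
    using iso by (auto simp: graph_iso_def)
  have fL: "ends L (g e) = f ` ends K e" if "e \<in> edges K" for e
    using graph_iso_ends[OF assms(1,2) iso that] .
  have endsK: "ends K e \<subseteq> verts K" if "e \<in> edges K" for e
    using assms(1) that by (auto simp: multigraph_def)
  let ?J = "induce L (f ` verts H)"
  have edgesH: "edges H = {e \<in> edges K. ends K e \<subseteq> verts H}" and endsH: "ends H = ends K"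
    by (subst H(4), simp add: induce_def)+
  have fH: "bij_betw f (verts H) (verts ?J)"
    by (rule bij_betw_subset[OF f H(1)]) (simp add: induce_def)
  \<comment> \<open>Injectivity of \<open>f\<close> on \<open>verts K\<close> ensures that the
    induced subgraph \<open>?J\<close> acquires no edge beyond the images of edges of
    \<open>H\<close>.\<close>
  have sub: "f ` ends K e \<subseteq> f ` verts H \<longleftrightarrow> ends K e \<subseteq> verts H" if "e \<in> edges K" for e
    using inj_on_image_mem_iff[of f "verts K" _ "verts H"] f endsK[OF that] H(1)
    unfolding bij_betw_def by blast
  have "g ` edges H = edges ?J"
    unfolding edgesH induce_def using sub
    by (auto simp: bij_betw_imp_surj_on[OF g, symmetric] fL, blast)
  then have gH: "bij_betw g (edges H) (edges ?J)"
    by (rule bij_betw_subset[OF g, rotated]) (auto simp: edgesH)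
  have "graph_iso H ?J f g"
    using iso fH gH H(1) unfolding graph_iso_def by (auto simp: edgesH endsH induce_def)
  moreover have "connected_graph ?J"
    by (rule connected_graph_image[OF H(3) fH, of g])
      (use bij_betwE[OF gH] in \<open>auto simp: edgesH endsH fL induce_def\<close>)
  moreover have "f ` verts H \<subseteq> verts L" "v \<in> f ` verts H"
    using bij_betwE[OF f] H(1,2) v by (auto simp: rev_image_eqI)
  ultimately show ?thesis
    using v by (auto simp: connected_induced_subgraphs_def isomorphic_def)
qed

section \<open>The rooted embeddability preorder\<close>

definition rooted_embeds :: "'v \<Rightarrow> ('v, 'e) mgraph \<Rightarrow> ('v, 'e) mgraph \<Rightarrow> bool" where
  "rooted_embeds v H K \<longleftrightarrow> (\<exists>J\<in>connected_induced_subgraphs K v. isomorphic v H J)"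

text \<open>The copy \<open>H'\<close> of \<open>H\<close> inside \<open>K\<close> is moved along
  \<open>K \<cong> K'\<close> into \<open>K'\<close>, which is itself an induced subgraph of
  \<open>L\<close>.\<close>

lemma rooted_embeds_trans:
  assumes "multigraph K" "multigraph L" "rooted_embeds v H K" "rooted_embeds v K L"
  shows "rooted_embeds v H L"
proof -
  obtain H' where H': "H' \<in> connected_induced_subgraphs K v" "isomorphic v H H'"
    using assms(3) by (auto simp: rooted_embeds_def)
  obtain K' where K': "K' \<in> connected_induced_subgraphs L v" "isomorphic v K K'"
    using assms(4) by (auto simp: rooted_embeds_def)
  obtain J where "J \<in> connected_induced_subgraphs K' v" "isomorphic v H' J"
    using isomorphic_connected_induced_subgraph[OF assms(1) _ K'(2) H'(1)]
      multigraph_connected_induced_subgraph[OF assms(2) K'(1)] by blast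
  then show ?thesis
    using connected_induced_subgraphs_trans[OF _ K'(1)] isomorphic_trans[OF H'(2)]
    by (auto simp: rooted_embeds_def)
qed

lemma isomorphic_card_verts: "isomorphic v H J \<Longrightarrow> card (verts H) = card (verts J)"
  using bij_betw_same_card unfolding isomorphic_def graph_iso_def by blast

text \<open>The copy \<open>J\<close> of \<open>H\<close> in \<open>K\<close> has at least as many
  vertices as \<open>K\<close>, hence all of them; an induced subgraph is determined by its
  vertices, so \<open>J = K\<close>.\<close>

lemma rooted_embeds_antisym:
  assumes "finite (verts H)" "finite (verts K)" "K \<in> connected_induced_subgraphs K v"
    and "rooted_embeds v H K" "rooted_embeds v K H"
  shows "isomorphic v H K"
proof -
  obtain J where J: "J \<in> connected_induced_subgraphs K v" "isomorphic v H J"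
    using assms(4) by (auto simp: rooted_embeds_def)
  obtain J' where J': "J' \<in> connected_induced_subgraphs H v" "isomorphic v K J'"
    using assms(5) by (auto simp: rooted_embeds_def)
  have "card (verts K) \<le> card (verts J)"
    using isomorphic_card_verts[OF J(2)] isomorphic_card_verts[OF J'(2)]
      card_mono[OF assms(1) connected_induced_subgraphsD(1)[OF J'(1)]] by simp
  then have "verts J = verts K"
    using card_seteq[OF assms(2) connected_induced_subgraphsD(1)[OF J(1)]] by simp
  then have "J = K"
    by (metis connected_induced_subgraphsD(4) J(1) assms(3))
  then show ?thesis
    using J(2) by simp
qed

section \<open>Domains of partial isomorphisms and generating sets\<close>

lemma rooted_tree_induced_subgraphs_connected:
  "rooted_tree_induced_subgraphs G v \<subseteq> connected_induced_subgraphs G v"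
proof
  fix H assume "H \<in> rooted_tree_induced_subgraphs G v"
  then obtain T where T: "H = induce G (verts T)" "subgraph T G" "tree T" "v \<in> verts T"
    by (auto simp: rooted_tree_induced_subgraphs_def)
  \<comment> \<open>Every edge of \<open>T\<close> therefore survives in the induced subgraph
    \<open>H\<close>, so the identity maps carry paths of \<open>T\<close> to paths of
    \<open>H\<close>.\<close>
  have "ends T e \<subseteq> verts T" if "e \<in> edges T" for e
    using T(2) that unfolding subgraph_def multigraph_def by blast
  then have "edges T \<subseteq> edges H" "ends H = ends T" "verts H = verts T"
    using T(2) by (auto simp: T(1) induce_def subgraph_def)
  then have "connected_graph H"
    using connected_graph_image[of T id H id] T(3) by (auto simp: tree_def)
  then show "H \<in> connected_induced_subgraphs G v"
    using T by (auto simp: connected_induced_subgraphs_def subgraph_def)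
qed

lemma Dom_connected_induced:
  "a \<in> Tisg G v \<Longrightarrow> Dom a \<in> connected_induced_subgraphs G v"
  using rooted_tree_induced_subgraphs_connected[of G v] unfolding Tisg_def by blast

lemma generating_set_iff:
  "generating_set G v I \<B> \<longleftrightarrow>
     \<B> \<subseteq> connected_induced_subgraphs G v \<and>
     (\<forall>a\<in>I. \<exists>B\<in>\<B>. rooted_embeds v (Dom a) B) \<and>
     (\<forall>B\<in>\<B>. \<exists>a\<in>I. isomorphic v (Dom a) B)"
  by (simp add: generating_set_def rooted_embeds_def)

lemma generating_set_Dom:
  assumes "I \<subseteq> Tisg G v" shows "generating_set G v I (Dom ` I)"
proof -
  have "Dom a \<in> connected_induced_subgraphs G v" if "a \<in> I" for a
    using assms that by (blast intro: Dom_connected_induced)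
  then show ?thesis
    unfolding generating_set_def
    by (intro conjI ballI) (auto intro: connected_induced_subgraphs_self isomorphic_refl)
qed

lemma generating_set_Un:
  "generating_set G v I \<B> \<Longrightarrow> generating_set G v J \<C> \<Longrightarrow>
    generating_set G v (I \<union> J) (\<B> \<union> \<C>)"
  unfolding generating_set_iff by (simp add: ball_Un bex_Un)

lemma semigroup_ideal_Un:
  "semigroup_ideal S f I \<Longrightarrow> semigroup_ideal S f J \<Longrightarrow> semigroup_ideal S f (I \<union> J)"
  by (auto simp: semigroup_ideal_def)

section \<open>Existence and uniqueness of bases\<close>

lemma generating_set_contains_basis:
  assumes "finite (verts G)" "generating_set G v I \<G>"
  shows "\<exists>\<B>\<subseteq>\<G>. basis G v I \<B>"
proof -
  have "finite \<G>"
    using assms finite_connected_induced_subgraphs finite_subset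
    by (metis generating_set_def)
  then have "finite {\<A>. \<A> \<subseteq> \<G> \<and> generating_set G v I \<A>}"
    by (auto intro: finite_subset[of _ "Pow \<G>"])
  from finite_has_minimal2[OF this, of \<G>] assms(2)
  obtain \<B> where "\<B> \<subseteq> \<G>" "generating_set G v I \<B>"
    and "\<forall>\<A>. \<A> \<subseteq> \<G> \<and> generating_set G v I \<A> \<longrightarrow> \<A> \<subseteq> \<B> \<longrightarrow> \<B> = \<A>"
    by auto
  \<comment> \<open>Minimality was obtained among generating subsets of \<open>\<G>\<close> only;
    this suffices because every subset of \<open>\<B>\<close> is a subset of
    \<open>\<G>\<close>.\<close>
  then show ?thesis
    unfolding basis_def by (intro exI[of _ \<B>]) blast
qed

text \<open>\<open>B\<close> is a copy of the domain of some \<open>a \<in> I \<subseteq> K\<close>,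
  and \<open>\<C>\<close> covers that domain. With \<open>I = K\<close> this compares two generating
  sets of one ideal; with general \<open>K\<close> it compares bases of nested ideals.\<close>

lemma generating_set_dominated:
  assumes "I \<subseteq> Tisg G v" "I \<subseteq> K" "generating_set G v I \<B>" "generating_set G v K \<C>" "B \<in> \<B>"
  shows "\<exists>C\<in>\<C>. rooted_embeds v B C"
proof -
  obtain a where a: "a \<in> I" "isomorphic v (Dom a) B"
    using assms(3,5) by (auto simp: generating_set_iff)
  obtain C where C: "C \<in> \<C>" "rooted_embeds v (Dom a) C"
    using a assms(2,4) unfolding generating_set_iff by blast
  have "isomorphic v B (Dom a)"
    using isomorphic_sym[OF a(2)] a(1) assms(1)
      connected_induced_subgraphsD(2)[OF Dom_connected_induced[of a G v]] by blast
  then show ?thesis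
    using C isomorphic_trans unfolding rooted_embeds_def by meson
qed

text \<open>If \<open>B\<close> embedded in another member \<open>C\<close>, everything covered by
  \<open>B\<close> would be covered by \<open>C\<close>, and removing \<open>B\<close> would leave a
  smaller generating set.\<close>

lemma basis_antichain:
  assumes "multigraph G" "basis G v I \<B>" "B \<in> \<B>" "C \<in> \<B>" "rooted_embeds v B C"
  shows "B = C"
proof (rule ccontr)
  assume "B \<noteq> C"
  have gen: "generating_set G v I \<B>"
    using assms(2) by (simp add: basis_def)
  then have "\<B> \<subseteq> connected_induced_subgraphs G v"
    by (simp add: generating_set_iff)
  then have multi: "multigraph D" if "D \<in> \<B>" for D
    using multigraph_connected_induced_subgraph[OF assms(1) subsetD] that by metis
  have "\<exists>D\<in>\<B> - {B}. rooted_embeds v (Dom a) D" if a: "a \<in> I" for a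
  proof -
    obtain D where D: "D \<in> \<B>" "rooted_embeds v (Dom a) D"
      using gen a by (auto simp: generating_set_iff)
    show ?thesis
    proof (cases "D = B")
      case True
      then have "rooted_embeds v (Dom a) C"
        using rooted_embeds_trans[OF multi multi _ assms(5)] D assms(3,4) by simp
      then show ?thesis
        using \<open>B \<noteq> C\<close> assms(4) by auto
    qed (use D in auto)
  qed
  then have "generating_set G v I (\<B> - {B})"
    using gen by (auto simp: generating_set_iff)
  then show False
    using assms(2,3) by (auto simp: basis_def)
qed

text \<open>Domination in both directions gives B \<preceq> C \<preceq> B', so \<open>B = B'\<close>
  by the antichain property and B \<cong> C by antisymmetry. Two matches in \<open>\<C>\<close> are
  isomorphic to each other, hence equal, again by the antichain property.\<close>

lemma basis_ex1_isomorphic: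
  assumes "multigraph G" "finite (verts G)" "I \<subseteq> Tisg G v"
    and "basis G v I \<B>" "basis G v I \<C>" "B \<in> \<B>"
  shows "\<exists>!C. C \<in> \<C> \<and> isomorphic v B C"
proof -
  have gen: "generating_set G v I \<B>" "generating_set G v I \<C>"
    using assms(4,5) by (auto simp: basis_def)
  then have cis: "D \<in> connected_induced_subgraphs G v" if "D \<in> \<B> \<union> \<C>" for D
    using that by (auto simp: generating_set_iff)
  have multi: "multigraph D" and fin: "finite (verts D)" if "D \<in> \<B> \<union> \<C>" for D
    using multigraph_connected_induced_subgraph[OF assms(1) cis[OF that]]
      finite_subset[OF connected_induced_subgraphsD(1)[OF cis[OF that]] assms(2)] by simp_all
  obtain C where C: "C \<in> \<C>" "rooted_embeds v B C"
    using generating_set_dominated[OF assms(3) _ gen assms(6)] by blast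
  obtain B' where B': "B' \<in> \<B>" "rooted_embeds v C B'"
    using generating_set_dominated[OF assms(3) _ gen(2,1) C(1)] by blast
  have "rooted_embeds v B B'"
    using rooted_embeds_trans[OF multi multi C(2) B'(2)] C(1) B'(1) by simp
  then have "B = B'"
    using basis_antichain[OF assms(1,4,6) B'(1)] by simp
  then have iso: "isomorphic v B C"
    using rooted_embeds_antisym[OF fin fin connected_induced_subgraphs_self[OF cis] C(2)]
      B' C(1) by auto
  have "D = C" if D: "D \<in> \<C>" "isomorphic v B D" for D
  proof -
    have "isomorphic v D C"
      using isomorphic_trans[OF isomorphic_sym[OF D(2)] iso]
        connected_induced_subgraphsD(2)[OF cis, of B] assms(6) by simp
    then have "rooted_embeds v D C"
      using connected_induced_subgraphs_self[OF cis, of C] C(1) by (auto simp: rooted_embeds_def)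
    then show ?thesis
      using basis_antichain[OF assms(1,5) D(1) C(1)] by simp
  qed
  then show ?thesis
    using C(1) iso by blast
qed

lemma basis_unique:
  assumes "multigraph G" "finite (verts G)" "I \<subseteq> Tisg G v" "basis G v I \<B>" "basis G v I \<C>"
  shows "\<exists>h. bij_betw h \<B> \<C> \<and> (\<forall>B\<in>\<B>. isomorphic v B (h B))"
proof -
  note match = basis_ex1_isomorphic[OF assms(1-3)]
  define h where "h B = (THE C. C \<in> \<C> \<and> isomorphic v B C)" for B
  define k where "k C = (THE B. B \<in> \<B> \<and> isomorphic v C B)" for C
  have h: "h B \<in> \<C>" "isomorphic v B (h B)" if "B \<in> \<B>" for B
    using theI'[OF match[OF assms(4,5) that]] by (simp_all add: h_def)
  have k: "k C \<in> \<B>" "isomorphic v C (k C)" if "C \<in> \<C>" for C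
    using theI'[OF match[OF assms(5,4) that]] by (simp_all add: k_def)
  \<comment> \<open>Matching a basis with itself shows that isomorphic members coincide; this makes
    \<open>h\<close> and \<open>k\<close> mutually inverse.\<close>
  have self: "D' = D"
    if "basis G v I \<A>" "D \<in> \<A>" "D' \<in> \<A>" "isomorphic v D D'" for \<A> D D'
    using match[OF that(1) that(1) that(2)] that(2-) isomorphic_refl by metis
  have "bij_betw h \<B> \<C>"
  proof (rule bij_betwI[where g = k])
    show "k (h B) = B" if "B \<in> \<B>" for B
      using self[OF assms(4) that k(1)[OF h(1)[OF that]]]
        isomorphic_trans[OF h(2)[OF that] k(2)[OF h(1)[OF that]]] by simp
    show "h (k C) = C" if "C \<in> \<C>" for C
      using self[OF assms(5) that h(1)[OF k(1)[OF that]]]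
        isomorphic_trans[OF k(2)[OF that] h(2)[OF k(1)[OF that]]] by simp
  qed (use h k in auto)
  then show ?thesis
    using h by blast
qed

text \<open>A basis of \<open>I\<close> is extracted from a generating set made of actual subgraphs
  of members of \<open>\<C>\<close>, so containment holds literally and not just up to
  isomorphism.\<close>

lemma basis_within_larger_basis:
  assumes "finite (verts G)" "I \<subseteq> Tisg G v" "I \<subseteq> K" "generating_set G v K \<C>"
  shows "\<exists>\<B>. basis G v I \<B> \<and> (\<forall>B\<in>\<B>. \<exists>C\<in>\<C>. B \<in> connected_induced_subgraphs C v)"
proof -
  \<comment> \<open>The second condition keeps only copies of domains from \<open>I\<close>, as the
    last clause of \<open>generating_set\<close> demands.\<close>
  define \<G> where "\<G> = {H. (\<exists>C\<in>\<C>. H \<in> connected_induced_subgraphs C v) \<and>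
    (\<exists>a\<in>I. isomorphic v (Dom a) H)}"
  have "\<G> \<subseteq> connected_induced_subgraphs G v"
    using assms(4) connected_induced_subgraphs_trans
    by (fastforce simp: \<G>_def generating_set_def)
  moreover have "\<exists>H\<in>\<G>. rooted_embeds v (Dom a) H" if a: "a \<in> I" for a
  proof -
    obtain C H where H: "C \<in> \<C>" "H \<in> connected_induced_subgraphs C v" "isomorphic v (Dom a) H"
      using assms(3,4) a unfolding generating_set_def by blast
    then have "H \<in> \<G>"
      using a by (auto simp: \<G>_def)
    then show ?thesis
      using H connected_induced_subgraphs_self[OF H(2)] unfolding rooted_embeds_def by blast
  qed
  ultimately have "generating_set G v I \<G>"
    by (auto simp: generating_set_iff \<G>_def)
  then obtain \<B> where "\<B> \<subseteq> \<G>" "basis G v I \<B>"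
    using generating_set_contains_basis[OF assms(1)] by blast
  then show ?thesis
    unfolding \<G>_def by blast
qed

text \<open>Bases being determined up to isomorphism, the claim on nested ideals takes two forms:
  embedding up to rooted isomorphism for arbitrary bases, and literal containment for a basis of
  \<open>I\<close> chosen to fit the given basis of \<open>K\<close>.\<close>

theorem theorem4p21:
  fixes G :: "('v, 'e) mgraph" and v :: 'v
  assumes "finite_multigraph G" and "v \<in> verts G"
  shows
    "(\<forall>I. tisg_ideal G v I \<longrightarrow> (\<exists>\<B>. basis G v I \<B>)) \<and>
     (\<forall>I \<B> \<B>'. tisg_ideal G v I \<and> basis G v I \<B> \<and> basis G v I \<B>' \<longrightarrow>
        (\<exists>h. bij_betw h \<B> \<B>' \<and> (\<forall>B\<in>\<B>. isomorphic v B (h B)))) \<and>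
     (\<forall>I \<G>. tisg_ideal G v I \<and> generating_set G v I \<G> \<longrightarrow>
        (\<exists>\<B>. \<B> \<subseteq> \<G> \<and> basis G v I \<B>)) \<and>
     (\<forall>I J \<B> \<C>. tisg_ideal G v I \<and> tisg_ideal G v J \<and> basis G v I \<B> \<and> basis G v J \<C> \<longrightarrow>
        tisg_ideal G v (I \<union> J) \<and> generating_set G v (I \<union> J) (\<B> \<union> \<C>)) \<and>
     (\<forall>I K. tisg_ideal G v I \<and> tisg_ideal G v K \<and> I \<subseteq> K \<longrightarrow>
        (\<forall>\<B> \<C>. basis G v I \<B> \<and> basis G v K \<C> \<longrightarrow>
           (\<forall>B\<in>\<B>. v \<in> verts B \<and>
              (\<exists>C\<in>\<C>. \<exists>H\<in>connected_induced_subgraphs C v. isomorphic v B H))) \<and>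
        (\<forall>\<C>. basis G v K \<C> \<longrightarrow>
           (\<exists>\<B>. basis G v I \<B> \<and> (\<forall>B\<in>\<B>. \<exists>C\<in>\<C>. B \<in> connected_induced_subgraphs C v))))"
proof -
  have G: "multigraph G" "finite (verts G)"
    using assms(1) by (auto simp: finite_multigraph_def)
  have sub: "I \<subseteq> Tisg G v" if "tisg_ideal G v I" for I
    using that by (simp add: semigroup_ideal_def)
  show ?thesis
  proof (intro conjI allI impI ballI; (elim conjE)?)
    show "\<exists>\<B>. basis G v I \<B>" if "tisg_ideal G v I" for I
      using generating_set_contains_basis[OF G(2) generating_set_Dom[OF sub[OF that]]] by blast
  next
    show "\<exists>h. bij_betw h \<B> \<B>' \<and> (\<forall>B\<in>\<B>. isomorphic v B (h B))"
      if "tisg_ideal G v I" "basis G v I \<B>" "basis G v I \<B>'" for I \<B> \<B>'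
      using basis_unique[OF G sub] that by blast
  next
    show "\<exists>\<B>\<subseteq>\<G>. basis G v I \<B>" if "generating_set G v I \<G>" for I \<G>
      using generating_set_contains_basis[OF G(2) that] .
  next
    show "tisg_ideal G v (I \<union> J)" if "tisg_ideal G v I" "tisg_ideal G v J" for I J
      using that by (rule semigroup_ideal_Un)
  next
    show "generating_set G v (I \<union> J) (\<B> \<union> \<C>)" if "basis G v I \<B>" "basis G v J \<C>" for I J \<B> \<C>
      using that by (auto simp: basis_def intro: generating_set_Un)
  next
    show "v \<in> verts B" if "basis G v I \<B>" "B \<in> \<B>" for I \<B> B
      using that connected_induced_subgraphsD(2)[of B G v]
      by (auto simp: basis_def generating_set_def)
  next
    show "\<exists>C\<in>\<C>. \<exists>H\<in>connected_induced_subgraphs C v. isomorphic v B H"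
      if "tisg_ideal G v I" "I \<subseteq> K" "basis G v I \<B>" "basis G v K \<C>" "B \<in> \<B>" for I K \<B> \<C> B
      using generating_set_dominated[OF sub[OF that(1)] that(2), of \<B> \<C> B] that(3-)
      by (simp add: basis_def rooted_embeds_def)
  next
    show "\<exists>\<B>. basis G v I \<B> \<and> (\<forall>B\<in>\<B>. \<exists>C\<in>\<C>. B \<in> connected_induced_subgraphs C v)"
      if "tisg_ideal G v I" "I \<subseteq> K" "basis G v K \<C>" for I K \<C>
      using basis_within_larger_basis[OF G(2) sub[OF that(1)] that(2), of \<C>] that(3)
      by (simp add: basis_def)
  qed
qed

end
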